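(* Let $\lambda\in\mathbb{L}$ be such that $\lambda$ is not the left endpoint of any maximal gap of the Lagrange spectrum. Then there exists an attainable irrational $\alpha$ with $\mu(\alpha)=\lambda$.
   Context: For real irrational $\alpha$, the Lagrange constant is defined by $\mu(\alpha)^{-1}=\liminf_{q\to\infty,\ q\in\mathbb{N},\ p\in\mathbb{Z}}|q(q\alpha-p)|$. The Lagrange spectrum $\mathbb{L}$ is the set of all finite values taken by $\mu(\alpha)$ as $\alpha$ ranges over the reals; it is a closed set. A maximal gap of $\mathbb{L}$ is a connected component $(a,b)$ of $\mathbb{R}\setminus\mathbb{L}$, i.e. an open interval containing no point of $\mathbb{L}$ whose endpoints lie in $\mathbb{L}$; $a$ is its left endpoint. An irrational $\alpha$ is called attainable if the inequality $|\alpha-p/q|\le \frac{1}{\mu(\alpha)q^2}$ has infinitely many solutions in integers $p$ and positive integers $q$. *)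

theory Defs
  imports "HOL-Analysis.Analysis"
begin

text \<open>The limit inferior is taken over all pairs \<open>(q, p)\<close> as \<open>q\<close> tends to infinity, with no
  restriction on \<open>p\<close>.  It may be \<open>0\<close>, in which case the Lagrange constant is \<open>\<infinity>\<close>
  (as \<open>inverse 0 = \<infinity>\<close> on \<^typ>\<open>ereal\<close>).\<close>

definition lagrange_constant :: "real \<Rightarrow> ereal" where
  "lagrange_constant \<alpha> =
     inverse (Liminf (filtercomap fst sequentially)
       (\<lambda>(q::nat, p::int). ereal \<bar>real q * (real q * \<alpha> - real_of_int p)\<bar>))"

definition lagrange_spectrum :: "real set" where
  "lagrange_spectrum = {l. \<exists>\<alpha>. \<alpha> \<notin> \<rat> \<and> lagrange_constant \<alpha> = ereal l}"

definition maximal_gap :: "real \<Rightarrow> real \<Rightarrow> bool" where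
  "maximal_gap a b \<longleftrightarrow> {a<..<b} \<in> components (- lagrange_spectrum)"

lemma maximal_gap_iff:
  "maximal_gap a b \<longleftrightarrow>
     a < b \<and> {a<..<b} \<inter> lagrange_spectrum = {} \<and> a \<in> lagrange_spectrum \<and> b \<in> lagrange_spectrum"
proof
  assume "maximal_gap a b"
  then have gap: "{a<..<b} \<in> components (- lagrange_spectrum)"
    by (simp add: maximal_gap_def)
  then have ne: "{a<..<b} \<noteq> {}" and sub: "{a<..<b} \<subseteq> - lagrange_spectrum"
    and mx: "\<And>T. \<lbrakk>T \<noteq> {}; T \<subseteq> - lagrange_spectrum; {a<..<b} \<subseteq> T; connected T\<rbrakk> \<Longrightarrow> T = {a<..<b}"
    unfolding in_components_maximal by blast+
  from ne have ab: "a < b" by simp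
  have "a \<in> lagrange_spectrum"
  proof (rule ccontr)
    assume a: "a \<notin> lagrange_spectrum"
    have "{a..<b} \<subseteq> insert a {a<..<b}" by auto
    with a sub have "{a..<b} \<subseteq> - lagrange_spectrum" by blast
    moreover have "{a..<b} \<noteq> {}" "{a<..<b} \<subseteq> {a..<b}" "connected {a..<b}"
      using ab by (auto simp: connected_Ico connected_Ioc)
    ultimately have "{a..<b} = {a<..<b}" using mx by blast
    moreover have "a \<in> {a..<b}" using ab by simp
    ultimately have "a \<in> {a<..<b}" by blast
    then show False by simp
  qed
  moreover have "b \<in> lagrange_spectrum"
  proof (rule ccontr)
    assume b: "b \<notin> lagrange_spectrum"
    have "{a<..b} \<subseteq> insert b {a<..<b}" by auto
    with b sub have "{a<..b} \<subseteq> - lagrange_spectrum" by blast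
    moreover have "{a<..b} \<noteq> {}" "{a<..<b} \<subseteq> {a<..b}" "connected {a<..b}"
      using ab by (auto simp: connected_Ico connected_Ioc)
    ultimately have "{a<..b} = {a<..<b}" using mx by blast
    moreover have "b \<in> {a<..b}" using ab by simp
    ultimately have "b \<in> {a<..<b}" by blast
    then show False by simp
  qed
  ultimately show "a < b \<and> {a<..<b} \<inter> lagrange_spectrum = {} \<and>
      a \<in> lagrange_spectrum \<and> b \<in> lagrange_spectrum"
    using ab sub by blast
next
  assume *: "a < b \<and> {a<..<b} \<inter> lagrange_spectrum = {} \<and>
      a \<in> lagrange_spectrum \<and> b \<in> lagrange_spectrum"
  have "T = {a<..<b}"
    if T: "T \<subseteq> - lagrange_spectrum" "{a<..<b} \<subseteq> T" "connected T" for T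
  proof
    show "T \<subseteq> {a<..<b}"
    proof
      fix x assume x: "x \<in> T"
      define m where "m = (a + b) / 2"
      have ab: "a < m" "m < b" using * by (auto simp: m_def)
      then have m: "m \<in> T" using T(2) by auto
      have "a \<notin> T" "b \<notin> T" using * T(1) by auto
      then have "\<not> x \<le> a" "\<not> b \<le> x"
        using connectedD_interval[OF T(3) x m, of a] connectedD_interval[OF T(3) m x, of b] ab
        by force+
      then show "x \<in> {a<..<b}" by simp
    qed
  qed (use T in blast)
  then show "maximal_gap a b"
    unfolding maximal_gap_def in_components_maximal using * by (auto simp: connected_Ioo)
qed

definition attainable :: "real \<Rightarrow> bool" where
  "attainable \<alpha> \<longleftrightarrow> \<alpha> \<notin> \<rat> \<and>
     infinite {(p::int, q::nat). q > 0 \<and>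
       ereal \<bar>\<alpha> - real_of_int p / real q\<bar> \<le> 1 / (lagrange_constant \<alpha> * ereal ((real q)\<^sup>2))}"

end

theory Submission
  imports Defs
begin

text \<open>Write \<open>\<alpha> = c + t\<^sub>0\<close> with \<open>t\<^sub>k = 1 / (a\<^sub>k + t\<^sub>k\<^sub>+\<^sub>1)\<close>, and let \<open>y\<^sub>k = q\<^sub>k\<^sub>-\<^sub>1 / q\<^sub>k\<close>.  The law of best
  approximation gives \<open>\<mu>(\<alpha>) = limsup (a\<^sub>k + t\<^sub>k\<^sub>+\<^sub>1 + y\<^sub>k)\<close>.  Suppose elements of the spectrum decrease
  strictly to \<open>b\<close>.  By compactness of the unit square, the states \<open>(t\<^sub>k, y\<^sub>k)\<close> of suitable expansions
  realising them return infinitely often to neighbourhoods of one common point \<open>(x, y)\<close>.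
  Cut out a word of digits between two such returns, long enough to contain a value greater than \<open>b\<close>
  near its middle.  As \<open>u \<mapsto> 1 / (d + u)\<close> contracts, concatenating such words for tolerances tending
  to \<open>0\<close> perturbs all values by amounts tending to \<open>0\<close>; the resulting number has constant \<open>b\<close>, and
  is attainable because each word contributes a value above \<open>b\<close>.

  Since \<open>b\<close> is then itself in the spectrum, which is unbounded, a point of the spectrum that is not
  such a limit from the right is the left endpoint of a maximal gap.\<close>

section \<open>Continued fractions and the Lagrange constant\<close>

text \<open>Indices are shifted by one, so that \<open>q\<^sub>k\<close> is \<open>qden a (Suc k)\<close> and \<open>q\<^sub>-\<^sub>1 = 0\<close> is \<open>qden a 0\<close>.\<close>

fun qden :: "(nat \<Rightarrow> int) \<Rightarrow> nat \<Rightarrow> int" where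
  "qden a 0 = 0"
| "qden a (Suc 0) = 1"
| "qden a (Suc (Suc k)) = a k * qden a (Suc k) + qden a k"

fun pnum :: "int \<Rightarrow> (nat \<Rightarrow> int) \<Rightarrow> nat \<Rightarrow> int" where
  "pnum c a 0 = 1"
| "pnum c a (Suc 0) = c"
| "pnum c a (Suc (Suc k)) = a k * pnum c a (Suc k) + pnum c a k"

text \<open>The digits before position k read backwards, [0; a_{k-1}, ..., a_0]. In this form a word
  of digits acts on it just as it acts on a tail; \<open>past_eq_qden\<close> identifies it with
  q_{k-1}/q_k.\<close>

primrec past :: "(nat \<Rightarrow> int) \<Rightarrow> nat \<Rightarrow> real" where
  "past a 0 = 0"
| "past a (Suc k) = 1 / (a k + past a k)"

text \<open>The reciprocal of q_k |q_k \<alpha> - p_k| at the k-th convergent, by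
  \<open>convergent_value\<close>.\<close>

definition cf_value :: "(nat \<Rightarrow> int) \<Rightarrow> (nat \<Rightarrow> real) \<Rightarrow> nat \<Rightarrow> real" where
  "cf_value a t k = a k + t (Suc k) + past a k"

lemma past_bounds:
  assumes "\<And>k. 1 \<le> a k"
  shows "0 \<le> past a k" "past a k \<le> 1"
proof -
  have "0 \<le> past a k \<and> past a k \<le> 1"
  proof (induction k)
    case (Suc k)
    have "1 \<le> real_of_int (a k)" using assms[of k] by linarith
    with Suc show ?case by simp
  qed simp
  then show "0 \<le> past a k" "past a k \<le> 1" by auto
qed

lemma qden_mono_unbounded:
  assumes "\<And>k. 1 \<le> a k"
  shows "1 \<le> qden a (Suc k) \<and> 0 \<le> qden a k \<and> qden a k \<le> qden a (Suc k) \<and> int k \<le> qden a (Suc k)"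
proof (induction k rule: induct_nat_012)
  case 1
  show ?case using assms[of 0] by simp
next
  case (ge2 n)
  have a: "1 \<le> a (Suc n)" "1 \<le> a n" using assms by auto
  have "qden a (Suc (Suc n)) * 1 \<le> qden a (Suc (Suc n)) * a (Suc n)"
    using ge2 a by (intro mult_left_mono) auto
  moreover have "qden a (Suc (Suc (Suc n))) = qden a (Suc (Suc n)) * a (Suc n) + qden a (Suc n)"
    by (simp add: mult.commute)
  ultimately show ?case using ge2 by linarith
qed simp_all

lemma past_eq_qden:
  assumes "\<And>k. 1 \<le> a k"
  shows "past a k = qden a k / qden a (Suc k)"
proof (induction k)
  case (Suc k)
  have "0 < qden a (Suc k)" using qden_mono_unbounded[of a k, OF assms] by linarith
  then show ?case by (simp add: Suc.IH add_divide_eq_iff mult.commute)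
qed simp

lemma convergent_det:
  "pnum c a k * qden a (Suc k) - pnum c a (Suc k) * qden a k = (-1) ^ k"
  by (induction k) (auto simp: algebra_simps)

text \<open>The tails are data tied to the digits by the recursion, which avoids limits of
  convergents. The number expanded is c + t 0, for any integer c.\<close>

locale cf_expansion =
  fixes a :: "nat \<Rightarrow> int" and t :: "nat \<Rightarrow> real"
  assumes a_pos: "1 \<le> a k"
    and t_pos: "0 < t k"
    and t_eq: "t k = 1 / (a k + t (Suc k))"
begin

lemma t_le_1: "t k \<le> 1"
proof -
  have "1 \<le> real_of_int (a k)" using a_pos[of k] by linarith
  then show ?thesis using t_eq[of k] t_pos[of "Suc k"] by simp
qed

lemma cf_value_eq: "cf_value a t k = 1 / t k + past a k"
  by (simp add: cf_value_def t_eq[of k])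

lemma cf_value_ge_1: "1 \<le> cf_value a t k"
  using a_pos[of k] t_pos[of "Suc k"] past_bounds(1)[of a k, OF a_pos] unfolding cf_value_def by linarith

section \<open>Errors of the convergents, best approximation and the Lagrange constant\<close>

definition approx_err :: "int \<Rightarrow> nat \<Rightarrow> real" where
  "approx_err c k = qden a k * (c + t 0) - pnum c a k"

text \<open>The errors D_k obey the same recurrence D_{k+2} = a_k D_{k+1} + D_k as numerators and
  denominators, and D_1 = - t_0 D_0; the recursion for the tails propagates this ratio.\<close>

lemma approx_err_Suc: "approx_err c (Suc k) = - t k * approx_err c k"
proof (induction k)
  case 0
  show ?case by (simp add: approx_err_def)
next
  case (Suc k)
  have *: "approx_err c (Suc (Suc k)) = a k * approx_err c (Suc k) + approx_err c k"
    by (simp add: approx_err_def algebra_simps)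
  have "t k > 0" by (rule t_pos)
  then have "approx_err c k = - (a k + t (Suc k)) * approx_err c (Suc k)"
    using Suc t_eq[of k] by (auto simp: field_simps)
  then show ?case unfolding * by (simp add: algebra_simps)
qed

lemma approx_err_nz: "approx_err c k \<noteq> 0"
proof (induction k)
  case (Suc k)
  then show ?case using t_pos[of k] by (simp add: approx_err_Suc)
qed (simp add: approx_err_def)

lemma approx_err_det:
  "real_of_int (qden a (Suc k)) * approx_err c k - qden a k * approx_err c (Suc k) = - ((-1) ^ k)"
proof -
  have "real_of_int (qden a (Suc k)) * approx_err c k - qden a k * approx_err c (Suc k)
    = - real_of_int (pnum c a k * qden a (Suc k) - pnum c a (Suc k) * qden a k)"
    by (simp add: approx_err_def algebra_simps)
  then show ?thesis unfolding convergent_det by simp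
qed

lemma qden_Suc_pos: "0 < qden a (Suc k)"
  using qden_mono_unbounded[of a k, OF a_pos] by linarith

text \<open>Putting D_{k+1} = - t_k D_k into the determinant identity gives (q_k + q_{k-1} t_k)
  |D_k| = 1. Multiplying |D_k| by t_k q_k then yields the reciprocal of 1/t_k + q_{k-1}/q_k.\<close>

lemma convergent_value:
  "qden a (Suc k) * \<bar>approx_err c (Suc k)\<bar> = 1 / cf_value a t k"
proof -
  let ?q = "real_of_int (qden a (Suc k))"
  have q: "0 < ?q" using qden_Suc_pos[of k] by simp
  have "(?q + qden a k * t k) * approx_err c k = - ((-1) ^ k)"
    using approx_err_det[of k c] by (simp add: approx_err_Suc algebra_simps)
  then have "\<bar>(?q + qden a k * t k) * approx_err c k\<bar> = 1" by simp
  moreover have "0 \<le> qden a k" using qden_mono_unbounded[of a k, OF a_pos] by simp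
  ultimately have *: "(?q + qden a k * t k) * \<bar>approx_err c k\<bar> = 1"
    using q t_pos[of k] by (simp add: abs_mult add_nonneg_nonneg)
  have "cf_value a t k = (?q + qden a k * t k) / (t k * ?q)"
    using q t_pos[of k] unfolding cf_value_eq past_eq_qden[of a, OF a_pos] by (simp add: field_simps)
  moreover have "\<bar>approx_err c k\<bar> = 1 / (?q + qden a k * t k)"
    using * by (metis mult_eq_0_iff nonzero_eq_divide_eq mult.commute zero_neq_one)
  ultimately show ?thesis using t_pos[of k] by (simp add: approx_err_Suc abs_mult)
qed

lemma approx_err_opposite: "approx_err c k * approx_err c (Suc k) < 0"
  using t_pos[of k] approx_err_nz[of c k]
  by (simp add: approx_err_Suc mult_less_0_iff zero_less_mult_iff)
    (metis linorder_neqE_linordered_idom)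

text \<open>Two consecutive convergents form a basis of the integer lattice. For 0 < q < q_{k+1} the
  first coordinate is nonzero and the coordinates do not have the same sign; since the two errors
  have opposite signs, their contributions add up in absolute value.\<close>

lemma best_approximation:
  assumes q: "0 < q" "q < qden a (Suc (Suc k))"
  shows "\<bar>approx_err c (Suc k)\<bar> \<le> \<bar>real_of_int q * (c + t 0) - real_of_int p\<bar>"
proof -
  define s :: int where "s = (-1) ^ Suc k"
  have ss: "s * s = 1" unfolding s_def by (simp flip: power_mult_distrib)
  let ?q0 = "qden a (Suc k)" and ?q1 = "qden a (Suc (Suc k))"
  let ?p0 = "pnum c a (Suc k)" and ?p1 = "pnum c a (Suc (Suc k))"
  have det: "?p0 * ?q1 - ?p1 * ?q0 = s" unfolding s_def by (rule convergent_det)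
  \<comment> \<open>Coordinates by Cramer's rule; the determinant s is 1 or -1, so multiplying by s
    replaces dividing by it.\<close>
  define x where "x = s * (p * ?q1 - q * ?p1)"
  define y where "y = s * (q * ?p0 - p * ?q0)"
  have "x * ?q0 + y * ?q1 = s * q * (?p0 * ?q1 - ?p1 * ?q0)"
    unfolding x_def y_def by algebra
  then have xq: "q = x * ?q0 + y * ?q1" unfolding det using ss by algebra
  have "x * ?p0 + y * ?p1 = s * p * (?p0 * ?q1 - ?p1 * ?q0)"
    unfolding x_def y_def by algebra
  then have xp: "p = x * ?p0 + y * ?p1" unfolding det using ss by algebra
  have e: "real_of_int q * (c + t 0) - real_of_int p
     = x * approx_err c (Suc k) + y * approx_err c (Suc (Suc k))"
    unfolding approx_err_def by (subst xq, subst xp) (simp add: algebra_simps)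
  have q0: "0 < ?q0" "0 < ?q1" by (rule qden_Suc_pos)+
  have x0: "x \<noteq> 0"
  proof
    assume "x = 0"
    then have qy: "q = y * ?q1" using xq by simp
    then have "0 < y" using qy q q0 by (simp add: zero_less_mult_iff)
    then have "1 * ?q1 \<le> y * ?q1" using q0 by (intro mult_right_mono) auto
    then show False using q qy by simp
  qed
  have xy: "x * y \<le> 0"
  proof (rule ccontr)
    assume "\<not> x * y \<le> 0"
    then consider "x > 0" "y > 0" | "x < 0" "y < 0" by (auto simp: not_le zero_less_mult_iff)
    then show False
    proof cases
      case 1
      have "1 * ?q1 \<le> y * ?q1" using 1 q0 by (intro mult_right_mono) auto
      moreover have "0 < x * ?q0" using 1 q0 by simp
      ultimately show False using xq q by simp
    next
      case 2
      have "x * ?q0 < 0" "y * ?q1 < 0" using 2 q0 by (simp_all add: mult_neg_pos)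
      then show False using xq q by simp
    qed
  qed
  let ?d0 = "approx_err c (Suc k)" and ?d1 = "approx_err c (Suc (Suc k))"
  have "(x * ?d0) * (y * ?d1) = real_of_int (x * y) * (?d0 * ?d1)" by simp
  also have "\<dots> \<ge> 0" using xy approx_err_opposite[of c "Suc k"]
    by (intro mult_nonpos_nonpos) (auto simp del: of_int_mult)
  finally have "\<bar>x * ?d0 + y * ?d1\<bar> = \<bar>x * ?d0\<bar> + \<bar>y * ?d1\<bar>"
    by (auto simp: zero_le_mult_iff)
  moreover have "1 * \<bar>?d0\<bar> \<le> \<bar>real_of_int x\<bar> * \<bar>?d0\<bar>" using x0 by (intro mult_right_mono) auto
  ultimately show ?thesis unfolding e by (simp add: abs_mult add_increasing2)
qed

text \<open>Convergents are particular pairs with q tending to infinity, which gives one inequality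
  between the lower limits. Conversely, a pair with q_k \<le> q < q_{k+1} does no better than the
  k-th convergent.\<close>

lemma lagrange_constant_eq:
  fixes c :: int
  shows "lagrange_constant (c + t 0) = limsup (\<lambda>k. ereal (cf_value a t k))"
proof -
  define F where "F = filtercomap (fst :: nat \<times> int \<Rightarrow> nat) sequentially"
  define f where "f = (\<lambda>(q::nat, p::int). ereal \<bar>real q * (real q * (c + t 0) - real_of_int p)\<bar>)"
  define h where "h k = (nat (qden a (Suc k)), pnum c a (Suc k))" for k
  have fh: "f (h k) = inverse (ereal (cf_value a t k))" for k
  proof -
    have "f (h k) = ereal (qden a (Suc k) * \<bar>approx_err c (Suc k)\<bar>)"
      using qden_Suc_pos[of k] by (simp add: f_def h_def approx_err_def abs_mult)
    then show ?thesis using cf_value_ge_1[of k] unfolding convergent_value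
      by (simp add: inverse_eq_divide)
  qed
  have lim: "filterlim h F sequentially"
    unfolding F_def filterlim_filtercomap_iff
  proof (rule filterlim_at_top_mono[OF filterlim_ident], rule always_eventually, rule allI)
    show "k \<le> (fst \<circ> h) k" for k
      using qden_mono_unbounded[of a k, OF a_pos] by (simp add: h_def le_nat_iff)
  qed
  have le: "Liminf F f \<le> liminf (\<lambda>k. f (h k))"
    unfolding le_Liminf_iff using lim by (blast dest: less_LiminfD eventually_compose_filterlim)
  have ge: "liminf (\<lambda>k. f (h k)) \<le> Liminf F f"
    unfolding le_Liminf_iff
  proof (intro allI impI)
    fix y assume "y < liminf (\<lambda>k. f (h k))"
    then have "\<forall>\<^sub>F k in sequentially. y < f (h k)" by (rule less_LiminfD)
    then obtain K where K: "\<And>k. K \<le> k \<Longrightarrow> y < f (h k)" by (auto simp: eventually_sequentially)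
    have "y < f z" if z: "nat (qden a (Suc K)) \<le> fst z" for z
    proof -
      obtain q p where zq: "z = (q, p)" by fastforce
      \<comment> \<open>The maximum exists because k \<le> q_k bounds the candidates by q.\<close>
      define k where "k = (GREATEST k. qden a (Suc k) \<le> int q)"
      have Kq: "qden a (Suc K) \<le> int q" using z zq by simp
      have bound: "k \<le> q" if "qden a (Suc k) \<le> int q" for k
        using that qden_mono_unbounded[of a k, OF a_pos] by linarith
      have k: "qden a (Suc k) \<le> int q"
        unfolding k_def by (rule GreatestI_nat[where P = "\<lambda>k. qden a (Suc k) \<le> int q", OF Kq bound])
      have Kk: "K \<le> k"
        unfolding k_def by (rule Greatest_le_nat[where P = "\<lambda>k. qden a (Suc k) \<le> int q", OF Kq bound])
      have "\<not> qden a (Suc (Suc k)) \<le> int q"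
        using Greatest_le_nat[where P = "\<lambda>k. qden a (Suc k) \<le> int q" and k = "Suc k", OF _ bound]
        unfolding k_def[symmetric] by fastforce
      then have "\<bar>approx_err c (Suc k)\<bar> \<le> \<bar>real_of_int (int q) * (c + t 0) - real_of_int p\<bar>"
        using k qden_Suc_pos[of k] by (intro best_approximation) auto
      then have "qden a (Suc k) * \<bar>approx_err c (Suc k)\<bar>
          \<le> real_of_int (int q) * \<bar>real_of_int (int q) * (c + t 0) - real_of_int p\<bar>"
        using k qden_Suc_pos[of k] by (intro mult_mono of_int_le_iff[THEN iffD2]) simp_all
      moreover have "f (h k) = ereal (qden a (Suc k) * \<bar>approx_err c (Suc k)\<bar>)"
        using qden_Suc_pos[of k] by (simp add: f_def h_def approx_err_def abs_mult)
      ultimately have "f (h k) \<le> f z" by (simp add: zq f_def abs_mult)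
      with K[OF Kk] show ?thesis by (rule less_le_trans)
    qed
    then show "\<forall>\<^sub>F z in F. y < f z"
      unfolding F_def eventually_filtercomap eventually_sequentially by blast
  qed
  have "lagrange_constant (c + t 0) = inverse (Liminf F f)"
    unfolding lagrange_constant_def F_def f_def by simp
  also have "Liminf F f = liminf (\<lambda>k. f (h k))" using le ge by (rule antisym)
  also have "\<dots> = liminf (\<lambda>k. inverse (ereal (cf_value a t k)))" by (simp only: fh)
  also have "\<dots> = inverse (limsup (\<lambda>k. ereal (cf_value a t k)))"
    using cf_value_ge_1 by (intro Liminf_inverse_ereal) (auto intro!: always_eventually order.trans[OF zero_le_one])
  \<comment> \<open>On \<open>ereal\<close>, inverting twice is the identity except at minus
    infinity, which the lower bound 1 excludes.\<close>
  also have "inverse (\<dots>) = limsup (\<lambda>k. ereal (cf_value a t k))"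
  proof -
    have "1 \<le> limsup (\<lambda>k. ereal (cf_value a t k))"
      using cf_value_ge_1 by (intro le_Limsup) (auto simp: one_ereal_def intro!: always_eventually)
    then show ?thesis by (cases "limsup (\<lambda>k. ereal (cf_value a t k))") auto
  qed
  finally show ?thesis .
qed

text \<open>If the number were r/s, then s |D| would be a nonzero integer, hence at least 1, for
  every error D. Yet q_k |D| \<le> 1 at the k-th convergent, and q_k exceeds s for large k.\<close>

lemma irrational: "c + t 0 \<notin> \<rat>" for c :: int
proof
  assume "c + t 0 \<in> \<rat>"
  then obtain r s :: int where s: "s > 0" and rs: "c + t 0 = of_int r / of_int s"
    by (metis Rats_cases')
  define k where "k = nat s + 1"
  have "int k \<le> qden a (Suc k)" using qden_mono_unbounded[of a k, OF a_pos] by blast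
  then have qs: "real_of_int s < qden a (Suc k)" using s unfolding k_def by linarith
  have e: "s * approx_err c (Suc k) = real_of_int (qden a (Suc k) * r - pnum c a (Suc k) * s)"
    using s unfolding approx_err_def rs by (simp add: field_simps)
  have "s * approx_err c (Suc k) \<noteq> 0" using s approx_err_nz[of c "Suc k"] by simp
  then have "qden a (Suc k) * r - pnum c a (Suc k) * s \<noteq> 0" unfolding e by (metis of_int_0)
  then have "1 \<le> \<bar>qden a (Suc k) * r - pnum c a (Suc k) * s\<bar>" by linarith
  then have "1 \<le> \<bar>s * approx_err c (Suc k)\<bar>" unfolding e by (metis of_int_1_le_iff of_int_abs)
  also have "\<dots> = s * \<bar>approx_err c (Suc k)\<bar>" using s by (simp add: abs_mult)
  also have "\<dots> < qden a (Suc k) * \<bar>approx_err c (Suc k)\<bar>"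
    using qs approx_err_nz[of c "Suc k"] by (intro mult_strict_right_mono) auto
  also have "\<dots> \<le> 1" using cf_value_ge_1[of k] unfolding convergent_value by simp
  finally show False by simp
qed

lemma attainable_if_frequently:
  fixes c :: int
  assumes l: "lagrange_constant (c + t 0) = ereal l" "0 < l"
    and freq: "\<exists>\<^sub>F k in sequentially. l \<le> cf_value a t k"
  shows "attainable (c + t 0)"
proof -
  define h where "h k = (pnum c a (Suc k), nat (qden a (Suc k)))" for k
  define K where "K = {k. l \<le> cf_value a t k}"
  have "infinite K" using freq unfolding K_def by (simp add: frequently_sequentially infinite_nat_iff_unbounded_le)
  have sub: "h ` K \<subseteq> {(p::int, q::nat). q > 0 \<and>
       ereal \<bar>(c + t 0) - real_of_int p / real q\<bar> \<le> 1 / (lagrange_constant (c + t 0) * ereal ((real q)\<^sup>2))}"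
  proof safe
    fix k p q assume k: "k \<in> K" and h: "(p, q) = h k"
    then have q: "int q = qden a (Suc k)" and p: "p = pnum c a (Suc k)"
      using qden_Suc_pos[of k] by (auto simp: h_def)
    then show q0: "0 < q" using qden_Suc_pos[of k] by simp
    have rq: "real q = qden a (Suc k)" using q by (metis of_int_of_nat_eq)
    have "\<bar>(c + t 0) - real_of_int p / real q\<bar> = \<bar>approx_err c (Suc k) / real q\<bar>"
      using q0 unfolding approx_err_def p rq[symmetric] by (simp add: field_simps)
    also have "\<dots> = (qden a (Suc k) * \<bar>approx_err c (Suc k)\<bar>) / (real q)\<^sup>2"
      using q0 unfolding rq[symmetric] by (simp add: power2_eq_square)
    also have "\<dots> = 1 / (cf_value a t k * (real q)\<^sup>2)"
      unfolding convergent_value by simp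
    also have "\<dots> \<le> 1 / (l * (real q)\<^sup>2)"
      using k l q0 unfolding K_def by (intro divide_left_mono mult_right_mono mult_pos_pos) auto
    finally have "ereal \<bar>(c + t 0) - real_of_int p / real q\<bar> \<le> ereal (1 / (l * (real q)\<^sup>2))" by simp
    also have "\<dots> = 1 / (lagrange_constant (c + t 0) * ereal ((real q)\<^sup>2))"
      using l q0 by (simp add: one_ereal_def)
    finally show "ereal \<bar>(c + t 0) - real_of_int p / real q\<bar>
      \<le> 1 / (lagrange_constant (c + t 0) * ereal ((real q)\<^sup>2))" .
  qed
  \<comment> \<open>No injectivity is used: since k \<le> q_k, a finite image would bound the
    indices themselves.\<close>
  have "infinite (h ` K)"
  proof
    assume fin: "finite (h ` K)"
    define M where "M = Max (snd ` h ` K)"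
    have "K \<subseteq> {..M}"
    proof
      fix k assume "k \<in> K"
      then have "snd (h k) \<le> M" unfolding M_def using fin by (intro Max_ge) auto
      moreover have "k \<le> snd (h k)"
        using qden_mono_unbounded[of a k, OF a_pos] by (simp add: h_def le_nat_iff)
      ultimately show "k \<in> {..M}" by simp
    qed
    with \<open>infinite K\<close> show False using finite_subset by blast
  qed
  then show ?thesis unfolding attainable_def
    using irrational infinite_super[OF sub] by simp
qed

end

section \<open>Words of digits\<close>

text \<open>The finite continued fraction of the word with u in place of the tail after it; as a map
  of u, a composition of inverse branches of the Gauss map.\<close>

definition word_val :: "int list \<Rightarrow> real \<Rightarrow> real" where
  "word_val w u = foldr (\<lambda>d x. 1 / (d + x)) w u"

lemma word_val_simps [simp]:
  "word_val [] u = u"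
  "word_val (d # w) u = 1 / (d + word_val w u)"
  "word_val (w @ w') u = word_val w (word_val w' u)"
  by (simp_all add: word_val_def)

lemma word_val_bounds:
  assumes "\<forall>d\<in>set w. 1 \<le> d" "0 \<le> u" "u \<le> 1"
  shows "0 \<le> word_val w u" "word_val w u \<le> 1"
proof -
  have "0 \<le> word_val w u \<and> word_val w u \<le> 1"
    using assms(1)
  proof (induction w)
    case Nil
    then show ?case using assms by simp
  next
    case (Cons d w)
    then have "1 \<le> real_of_int d" by simp
    with Cons show ?case by simp
  qed
  then show "0 \<le> word_val w u" "word_val w u \<le> 1" by auto
qed

lemma cf_step_nonexpansive:
  fixes x y :: real
  assumes "1 \<le> d" "0 \<le> x" "0 \<le> y"
  shows "\<bar>1 / (d + x) - 1 / (d + y)\<bar> \<le> \<bar>x - y\<bar>"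
proof -
  have "1 / (d + x) - 1 / (d + y) = (y - x) / ((d + x) * (d + y))"
    using assms by (simp add: field_simps)
  then have "\<bar>1 / (d + x) - 1 / (d + y)\<bar> = \<bar>x - y\<bar> / ((d + x) * (d + y))"
    using assms by (simp add: abs_mult abs_minus_commute)
  also have "\<dots> \<le> \<bar>x - y\<bar> / 1"
    using assms mult_mono[of 1 "d + x" 1 "d + y"] by (intro divide_left_mono) auto
  finally show ?thesis by simp
qed

text \<open>One step is no uniform contraction: for d = 1 its slope at 0 is -1. After two steps each
  denominator is at least 2, whence the factor 1/4.\<close>

lemma cf_two_steps_contract:
  fixes x y :: real
  assumes "1 \<le> d" "1 \<le> e" "0 \<le> x" "0 \<le> y"
  shows "\<bar>1 / (d + 1 / (e + x)) - 1 / (d + 1 / (e + y))\<bar> \<le> \<bar>x - y\<bar> / 4"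
proof -
  have p: "2 \<le> d * (e + x) + 1" "2 \<le> d * (e + y) + 1"
    using assms mult_mono[of 1 d 1 "e + x"] mult_mono[of 1 d 1 "e + y"] by auto
  have "1 / (d + 1 / (e + z)) = (e + z) / (d * (e + z) + 1)" if "0 \<le> z" for z
    using assms that by (simp add: field_simps)
  then have "1 / (d + 1 / (e + x)) - 1 / (d + 1 / (e + y))
      = (e + x) / (d * (e + x) + 1) - (e + y) / (d * (e + y) + 1)" using assms by simp
  also have "\<dots> = (x - y) / ((d * (e + x) + 1) * (d * (e + y) + 1))"
    using p by (subst diff_frac_eq) (auto simp: algebra_simps)
  finally have "\<bar>1 / (d + 1 / (e + x)) - 1 / (d + 1 / (e + y))\<bar>
      = \<bar>x - y\<bar> / ((d * (e + x) + 1) * (d * (e + y) + 1))"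
    using p by (simp add: abs_mult)
  also have "\<dots> \<le> \<bar>x - y\<bar> / 4"
    using p mult_mono[OF p] by (intro divide_left_mono) auto
  finally show ?thesis .
qed

lemma word_val_nonexpansive:
  assumes "\<forall>d\<in>set w. 1 \<le> d" "0 \<le> u" "u \<le> 1" "0 \<le> v" "v \<le> 1"
  shows "\<bar>word_val w u - word_val w v\<bar> \<le> \<bar>u - v\<bar>"
  using assms(1)
proof (induction w)
  case (Cons d w)
  have "\<bar>word_val (d # w) u - word_val (d # w) v\<bar> \<le> \<bar>word_val w u - word_val w v\<bar>"
    unfolding word_val_simps using Cons.prems assms
    by (intro cf_step_nonexpansive word_val_bounds) auto
  with Cons show ?case by simp
qed simp

text \<open>Each pair of digits contributes 1/4; the leading factor 2 absorbs an unpaired last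
  digit.\<close>

lemma word_val_contract:
  assumes "\<forall>d\<in>set w. 1 \<le> d" "0 \<le> u" "u \<le> 1" "0 \<le> v" "v \<le> 1"
  shows "\<bar>word_val w u - word_val w v\<bar> \<le> 2 * (1/2) ^ length w"
  using assms(1)
proof (induction w rule: induct_list012)
  case 1
  then show ?case using assms by simp
next
  case (2 d)
  then show ?case using word_val_nonexpansive[of "[d]" u v] assms by simp
next
  case (3 d e w)
  have "\<bar>word_val (d # e # w) u - word_val (d # e # w) v\<bar> \<le> \<bar>word_val w u - word_val w v\<bar> / 4"
    unfolding word_val_simps using 3(3) assms
    by (intro cf_two_steps_contract word_val_bounds) auto
  with 3 show ?case by simp
qed

text \<open>The value at position i inside the word when the word is followed by the tail u and
  preceded by the reversed past v.\<close>

definition entry_val :: "int list \<Rightarrow> nat \<Rightarrow> real \<Rightarrow> real \<Rightarrow> real" where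
  "entry_val w i u v = w ! i + word_val (drop (Suc i) w) u + word_val (rev (take i w)) v"

lemma past_eq_word_val:
  "k \<le> m \<Longrightarrow> past a m = word_val (rev (map a [k..<m])) (past a k)"
  by (induction m rule: dec_induct) auto

context cf_expansion
begin

lemma t_eq_word_val: "k \<le> m \<Longrightarrow> t k = word_val (map a [k..<m]) (t m)"
proof (induction m rule: dec_induct)
  case (step m)
  then show ?case by (simp add: t_eq[of m])
qed simp

lemma cf_value_eq_entry_val:
  assumes "i < m"
  shows "cf_value a t (k + i) = entry_val (map a [k..<k + m]) i (t (k + m)) (past a k)"
proof -
  have "take i (map a [k..<k + m]) = map a [k..<k + i]"
    using assms by (simp add: take_map)
  moreover have "drop (Suc i) (map a [k..<k + m]) = map a [Suc (k + i)..<k + m]"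
    by (simp add: drop_map)
  ultimately show ?thesis
    using assms t_eq_word_val[of "Suc (k + i)" "k + m"] past_eq_word_val[of k "k + i" a]
    by (simp add: cf_value_def entry_val_def)
qed

end

section \<open>Existence of expansions and the spectrum in terms of digits\<close>

text \<open>The numbers compatible with the first m digits form nested nonempty compact sets. A
  common point serves as the tail at 0, and the recursion solved for the next tail forces all
  others.\<close>

lemma cf_expansion_exists:
  fixes a :: "nat \<Rightarrow> int"
  assumes a: "\<And>k. 1 \<le> a k"
  shows "\<exists>t :: nat \<Rightarrow> real. cf_expansion a t"
proof -
  define W where "W k m = map a [k..<m]" for k m
  have W: "\<forall>d\<in>set (W k m). 1 \<le> d" for k m using a by (auto simp: W_def)
  define S where "S m = word_val (W 0 m) ` {0..1}" for m
  have W_Suc: "W 0 (Suc m) = W 0 m @ [a m]" for m by (simp add: W_def)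
  have "\<Inter>(range S) \<noteq> {}"
  proof (rule compact_nest)
    fix m
    have "continuous_on {0..1} (word_val (W 0 m))"
      unfolding continuous_on_iff dist_real_def
    proof (intro ballI allI impI exI conjI)
      fix x e u :: real
      assume "0 < e" "x \<in> {0..1}" "u \<in> {0..1}" "\<bar>u - x\<bar> < e"
      then show "\<bar>word_val (W 0 m) u - word_val (W 0 m) x\<bar> < e"
        using word_val_nonexpansive[OF W[of 0 m], of u x] by auto
    qed
    then show "compact (S m)" unfolding S_def by (intro compact_continuous_image) auto
    show "S m \<noteq> {}" unfolding S_def by simp
  next
    fix m n :: nat assume "m \<le> n"
    then show "S n \<subseteq> S m"
    proof (rule lift_Suc_antimono_le[rotated])
      fix m
      have "1 / (a m + u) \<in> {0..1}" if "u \<in> {0..1}" for u :: real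
        using word_val_bounds[of "[a m]" u] a that by simp
      then show "S (Suc m) \<subseteq> S m" unfolding S_def W_Suc word_val_simps by blast
    qed
  qed
  then obtain x where x: "\<And>m. x \<in> S m" by blast
  define t where "t = rec_nat x (\<lambda>k y. 1 / y - a k)"
  have t_simps: "t 0 = x" "t (Suc k) = 1 / t k - a k" for k by (simp_all add: t_def)
  \<comment> \<open>Solving for the next tail strips the outer digits of any truncation. With m = k
    this puts the tail in [0,1]; with m = k + 1 it gives the recursion.\<close>
  have t_word: "t k = word_val (W k m) u"
    if "x = word_val (W 0 m) u" "k \<le> m" "u \<in> {0..1}" for k m u
    using that(2)
  proof (induction k)
    case 0
    then show ?case using that by (simp add: t_simps)
  next
    case (Suc k)
    have "W k m = a k # W (Suc k) m" using Suc.prems by (simp add: W_def upt_conv_Cons)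
    moreover have "0 \<le> word_val (W (Suc k) m) u" using word_val_bounds[OF W] that by simp
    ultimately show ?case using Suc a[of k] by (simp add: t_simps)
  qed
  have t_nn: "0 \<le> t k" for k
  proof -
    obtain u where "u \<in> {0..1}" "x = word_val (W 0 k) u" using x[of k] unfolding S_def by blast
    then show ?thesis using t_word[of k u k] by (simp add: W_def)
  qed
  have t_eq: "t k = 1 / (a k + t (Suc k))" for k
  proof -
    obtain u where u: "u \<in> {0..1}" "x = word_val (W 0 (Suc k)) u"
      using x[of "Suc k"] unfolding S_def by blast
    then show ?thesis using t_word[of "Suc k" u k] t_word[of "Suc k" u "Suc k"]
      by (simp add: W_def)
  qed
  have "cf_expansion a t"
  proof
    fix k
    have "0 < a k + t (Suc k)" using a[of k] t_nn[of "Suc k"] by linarith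
    then show "0 < t k" by (subst t_eq) simp
  qed (rule a t_eq)+
  then show ?thesis by blast
qed

text \<open>Iterates of the Gauss map stay irrational, so no tail vanishes and the expansion never
  stops.\<close>

lemma irrational_cf_expansion:
  fixes \<alpha> :: real
  assumes "\<alpha> \<notin> \<rat>"
  shows "\<exists>(a :: nat \<Rightarrow> int) (t :: nat \<Rightarrow> real). cf_expansion a t \<and> \<alpha> = \<lfloor>\<alpha>\<rfloor> + t 0"
proof -
  define t where "t = rec_nat (frac \<alpha>) (\<lambda>_ y. frac (1 / y))"
  have t_simps: "t 0 = frac \<alpha>" "t (Suc k) = frac (1 / t k)" for k by (simp_all add: t_def)
  have frac_irr: "frac x \<notin> \<rat>" if "x \<notin> \<rat>" for x :: real
  proof
    assume "frac x \<in> \<rat>"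
    then have "frac x + of_int \<lfloor>x\<rfloor> \<in> \<rat>" by (intro Rats_add Rats_of_int)
    then show False using that by (simp add: frac_def)
  qed
  have irr: "t k \<notin> \<rat>" for k
  proof (induction k)
    case (Suc k)
    have "1 / t k \<notin> \<rat>"
    proof
      assume "1 / t k \<in> \<rat>"
      then have "inverse (1 / t k) \<in> \<rat>" by (rule Rats_inverse)
      then show False using Suc by simp
    qed
    then show ?case unfolding t_simps by (rule frac_irr)
  qed (use assms frac_irr in \<open>simp add: t_simps\<close>)
  have "t k = frac (t k)" for k
    by (cases k) (simp_all add: t_simps)
  then have t01: "0 < t k" "t k < 1" for k
    using irr[of k] frac_ge_0[of "t k"] frac_lt_1[of "t k"] by (metis Rats_0 less_eq_real_def)+
  have "cf_expansion (\<lambda>k. \<lfloor>1 / t k\<rfloor>) t"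
  proof
    fix k
    show "1 \<le> \<lfloor>1 / t k\<rfloor>" using t01[of k] by (simp add: le_floor_iff)
    show "t k = 1 / (real_of_int \<lfloor>1 / t k\<rfloor> + t (Suc k))"
      using t01[of k] by (simp add: t_simps frac_def)
  qed (rule t01)
  moreover have "\<alpha> = \<lfloor>\<alpha>\<rfloor> + t 0" by (simp add: t_simps frac_def)
  ultimately show ?thesis by blast
qed

lemma lagrange_spectrum_iff:
  "l \<in> lagrange_spectrum \<longleftrightarrow>
    (\<exists>(a :: nat \<Rightarrow> int) (t :: nat \<Rightarrow> real). cf_expansion a t \<and> limsup (\<lambda>k. ereal (cf_value a t k)) = ereal l)"
proof
  assume "l \<in> lagrange_spectrum"
  then obtain \<alpha> where "\<alpha> \<notin> \<rat>" and l: "lagrange_constant \<alpha> = ereal l"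
    unfolding lagrange_spectrum_def by blast
  then obtain a and t :: "nat \<Rightarrow> real" where at: "cf_expansion a t" "\<alpha> = \<lfloor>\<alpha>\<rfloor> + t 0"
    using irrational_cf_expansion by blast
  then show "\<exists>(a :: nat \<Rightarrow> int) (t :: nat \<Rightarrow> real). cf_expansion a t \<and> limsup (\<lambda>k. ereal (cf_value a t k)) = ereal l"
    using l cf_expansion.lagrange_constant_eq[OF at(1), of "\<lfloor>\<alpha>\<rfloor>"] by metis
next
  assume "\<exists>(a :: nat \<Rightarrow> int) (t :: nat \<Rightarrow> real). cf_expansion a t \<and> limsup (\<lambda>k. ereal (cf_value a t k)) = ereal l"
  then obtain a and t :: "nat \<Rightarrow> real" where at: "cf_expansion a t" "limsup (\<lambda>k. ereal (cf_value a t k)) = ereal l"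
    by blast
  then show "l \<in> lagrange_spectrum"
    unfolding lagrange_spectrum_def
    using cf_expansion.lagrange_constant_eq[OF at(1), of 0] cf_expansion.irrational[OF at(1), of 0]
    by auto
qed

lemma limsup_eq_erealD:
  assumes "limsup (\<lambda>k. ereal (V k)) = ereal l" "0 < e"
  shows "\<forall>\<^sub>F k in sequentially. V k < l + e" "\<exists>\<^sub>F k in sequentially. l - e < V k"
proof -
  have "limsup (\<lambda>k. ereal (V k)) < ereal (l + e)" using assms by simp
  then show "\<forall>\<^sub>F k in sequentially. V k < l + e" by (auto dest: Limsup_lessD)
  show "\<exists>\<^sub>F k in sequentially. l - e < V k"
  proof (rule ccontr)
    assume "\<not> ?thesis"
    then have "\<forall>\<^sub>F k in sequentially. ereal (V k) \<le> ereal (l - e)"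
      by (simp add: not_frequently not_less)
    then have "limsup (\<lambda>k. ereal (V k)) \<le> ereal (l - e)" by (rule Limsup_bounded)
    then show False using assms by simp
  qed
qed

text \<open>The lower bound carries no tolerance because the concatenated expansion reaches its
  limsup infinitely often; the same fact later gives attainability.\<close>

lemma limsup_eq_erealI:
  assumes up: "\<And>e. 0 < e \<Longrightarrow> \<forall>\<^sub>F k in sequentially. V k \<le> l + e"
    and low: "\<exists>\<^sub>F k in sequentially. l \<le> V k"
  shows "limsup (\<lambda>k. ereal (V k)) = ereal l"
proof (rule antisym)
  show "limsup (\<lambda>k. ereal (V k)) \<le> ereal l"
  proof (rule ereal_le_epsilon2)
    fix e :: real assume "0 < e"
    then show "limsup (\<lambda>k. ereal (V k)) \<le> ereal l + ereal e"
      using up by (intro Limsup_bounded) simp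
  qed
  show "ereal l \<le> limsup (\<lambda>k. ereal (V k))"
  proof (rule ccontr)
    assume "\<not> ?thesis"
    then have "\<forall>\<^sub>F k in sequentially. ereal (V k) < ereal l" by (intro Limsup_lessD) simp
    then show False using low by (simp add: frequently_def not_le)
  qed
qed

text \<open>For the constant digit m all values lie in [m, m + 2], so the limsup is finite and at
  least m.\<close>

lemma lagrange_spectrum_unbounded: "\<exists>l'\<in>lagrange_spectrum. l < l'"
proof -
  define m where "m = max 1 (\<lceil>l\<rceil> + 1)"
  have m: "1 \<le> m" "l < m" unfolding m_def by linarith+
  then obtain t :: "nat \<Rightarrow> real" where "cf_expansion (\<lambda>_. m) t" using cf_expansion_exists[of "\<lambda>_. m"] by auto
  then interpret cf_expansion "\<lambda>_. m" t .
  define V where "V = cf_value (\<lambda>_. m) t"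
  have V: "m \<le> V k" "V k \<le> m + 2" for k
    using t_pos[of "Suc k"] t_le_1[of "Suc k"] past_bounds[of "\<lambda>_. m" k] m
    unfolding V_def cf_value_def by auto
  have "ereal m \<le> limsup (\<lambda>k. ereal (V k))"
    using V by (intro le_Limsup) (auto intro: always_eventually)
  moreover have "limsup (\<lambda>k. ereal (V k)) \<le> ereal (m + 2)"
    using V by (intro Limsup_bounded) (auto intro: always_eventually)
  ultimately obtain l' :: real where l': "limsup (\<lambda>k. ereal (V k)) = ereal l'" "m \<le> l'"
    by (cases "limsup (\<lambda>k. ereal (V k))") auto
  then have "l' \<in> lagrange_spectrum"
    using cf_expansion_axioms unfolding lagrange_spectrum_iff V_def by blast
  with l' m show ?thesis by (intro bexI[of _ l']) auto
qed

section \<open>Concatenating words with nearby end states\<close>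

text \<open>A link is a finite word between two positions of an expansion whose states (future tail,
  reversed past) are both close to \<open>(x, y)\<close>.  Consecutive links can be concatenated because the
  bounds hold for every surrounding context \<open>u\<close>, \<open>v\<close>.\<close>

definition is_link :: "real \<Rightarrow> real \<Rightarrow> real \<Rightarrow> real \<Rightarrow> int list \<Rightarrow> bool" where
  "is_link x y b \<delta> w \<longleftrightarrow> (\<forall>d\<in>set w. 1 \<le> d) \<and>
    (\<forall>u\<in>{0..1}. \<forall>v\<in>{0..1}.
      \<bar>word_val w u - x\<bar> \<le> \<delta> \<and> \<bar>word_val (rev w) v - y\<bar> \<le> \<delta> \<and>
      (\<forall>i<length w. entry_val w i u v \<le> b + \<delta> + \<bar>u - x\<bar> + \<bar>v - y\<bar>) \<and>
      (\<exists>i<length w. b < entry_val w i u v))"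

text \<open>The word runs from a return to (x, y) at k to a later one at k', around a position j
  whose value exceeds (l + b)/2. With at least m digits on either side of j, a change of context
  cannot push that value down to b; the length also fixes both end states.\<close>

lemma (in cf_expansion) link_exists:
  assumes l: "limsup (\<lambda>k. ereal (cf_value a t k)) = ereal l" "b < l" "l < b + \<delta> / 2"
    and freq: "\<exists>\<^sub>F k in sequentially. \<bar>t k - x\<bar> < \<delta> / 8 \<and> \<bar>past a k - y\<bar> < \<delta> / 8"
  shows "\<exists>w. is_link x y b \<delta> w"
proof -
  have \<delta>: "0 < \<delta>" using l by linarith
  \<comment> \<open>The cap \<delta>/4 serves the end states. The cap (l - b)/8 serves the value at
    j, which exceeds b by more than (l - b)/2 and drops by at most 2e.\<close>
  define e where "e = min (\<delta> / 4) ((l - b) / 8)"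
  have e: "0 < e" "e \<le> \<delta> / 4" "e \<le> (l - b) / 8" using \<delta> l by (auto simp: e_def)
  obtain m where m: "(1/2) ^ m < e / 2" using real_arch_pow_inv[of "e / 2" "1/2"] e by auto
  have small: "2 * (1/2) ^ n \<le> e" if "m \<le> n" for n
  proof -
    have "(1/2 :: real) ^ n \<le> (1/2) ^ m" using that by (intro power_decreasing) auto
    with m show ?thesis by linarith
  qed
  obtain K where K: "\<And>k. K \<le> k \<Longrightarrow> cf_value a t k < l + \<delta> / 4"
    using limsup_eq_erealD(1)[OF l(1), of "\<delta> / 4"] \<delta> by (auto simp: eventually_sequentially)
  obtain k where k: "K \<le> k" "\<bar>t k - x\<bar> < \<delta> / 8" "\<bar>past a k - y\<bar> < \<delta> / 8"
    using freq unfolding frequently_sequentially by blast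
  have "\<exists>\<^sub>F j in sequentially. l - (l - b) / 2 < cf_value a t j"
    using l by (intro limsup_eq_erealD) auto
  then obtain j where j: "k + m \<le> j" "l - (l - b) / 2 < cf_value a t j"
    unfolding frequently_sequentially by blast
  obtain k' where k': "Suc j + m \<le> k'" "\<bar>t k' - x\<bar> < \<delta> / 8" "\<bar>past a k' - y\<bar> < \<delta> / 8"
    using freq unfolding frequently_sequentially by blast
  define L where "L = k' - k"
  have L: "k' = k + L" "Suc m \<le> L" using j k' by (auto simp: L_def)
  define w where "w = map a [k..<k + L]"
  have len: "length w = L" by (simp add: w_def)
  have digits: "\<forall>d\<in>set w. 1 \<le> d" using a_pos by (auto simp: w_def)
  then have sub: "\<forall>d\<in>set (drop i w). 1 \<le> d" "\<forall>d\<in>set (rev (take i w)). 1 \<le> d"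
    "\<forall>d\<in>set (rev w). 1 \<le> d" for i by (auto dest: in_set_dropD in_set_takeD)
  have t01: "0 \<le> t n" "t n \<le> 1" and p01: "0 \<le> past a n" "past a n \<le> 1" for n
    using t_pos[of n] t_le_1[of n] past_bounds[of a n, OF a_pos] by auto
  have vals: "cf_value a t (k + i) = entry_val w i (t k') (past a k)" if "i < L" for i
    using cf_value_eq_entry_val[OF that, of k] by (simp add: w_def L(1))
  have tk: "t k = word_val w (t k')" and pk': "past a k' = word_val (rev w) (past a k)"
    unfolding w_def L(1) by (rule t_eq_word_val past_eq_word_val; simp)+
  have "\<bar>word_val w u - x\<bar> \<le> \<delta> \<and> \<bar>word_val (rev w) v - y\<bar> \<le> \<delta> \<and>
      (\<forall>i<length w. entry_val w i u v \<le> b + \<delta> + \<bar>u - x\<bar> + \<bar>v - y\<bar>) \<and>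
      (\<exists>i<length w. b < entry_val w i u v)"
    if "u \<in> {0..1}" "v \<in> {0..1}" for u v
  proof (intro conjI allI impI)
    have u: "0 \<le> u" "u \<le> 1" and v: "0 \<le> v" "v \<le> 1" using that by auto
    have "\<bar>word_val w u - word_val w (t k')\<bar> \<le> 2 * (1/2) ^ L"
      using word_val_contract[OF digits u t01] by (simp add: len)
    then show "\<bar>word_val w u - x\<bar> \<le> \<delta>" using small[of L] L(2) k(2) e unfolding tk by linarith
    have "\<bar>word_val (rev w) v - word_val (rev w) (past a k)\<bar> \<le> 2 * (1/2) ^ L"
      using word_val_contract[OF sub(3) v p01] by (simp add: len)
    then show "\<bar>word_val (rev w) v - y\<bar> \<le> \<delta>"
      using small[of L] L(2) k'(3) e unfolding pk' by linarith
    \<comment> \<open>Near the ends of the word contraction gains nothing, so only nonexpansiveness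
      is used and the distances of u and v remain. The budget is \<delta>/2 for l - b, \<delta>/4
      for values above l, and \<delta>/8 for each of the two returns.\<close>
    show "entry_val w i u v \<le> b + \<delta> + \<bar>u - x\<bar> + \<bar>v - y\<bar>" if "i < length w" for i
    proof -
      have "entry_val w i u v \<le> cf_value a t (k + i) + \<bar>u - t k'\<bar> + \<bar>v - past a k\<bar>"
        using that vals[of i] word_val_nonexpansive[OF sub(1) u t01, of "Suc i" k']
          word_val_nonexpansive[OF sub(2) v p01, of i k]
        unfolding entry_val_def len by linarith
      moreover have "cf_value a t (k + i) < l + \<delta> / 4" using K k(1) by simp
      ultimately show ?thesis using l(3) k'(2) k(3) by linarith
    qed
    define i where "i = j - k"
    have i: "m \<le> i" "i < L" "k + i = j" "m \<le> L - Suc i" using j k' by (auto simp: i_def L_def)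
    have "\<bar>word_val (drop (Suc i) w) u - word_val (drop (Suc i) w) (t k')\<bar> \<le> 2 * (1/2) ^ (L - Suc i)"
      using word_val_contract[OF sub(1) u t01, of "Suc i" k'] by (simp add: len)
    moreover have "\<bar>word_val (rev (take i w)) v - word_val (rev (take i w)) (past a k)\<bar> \<le> 2 * (1/2) ^ i"
      using word_val_contract[OF sub(2) v p01, of i k] i(2) by (simp add: len)
    ultimately have "cf_value a t j \<le> entry_val w i u v + 2 * e"
      using vals[OF i(2)] small[OF i(1)] small[OF i(4)] unfolding entry_val_def i(3) by linarith
    then have "b < entry_val w i u v" using j(2) e(3) l(2) by argo
    then show "\<exists>i<length w. b < entry_val w i u v" using i(2) len by blast
  qed
  then show ?thesis unfolding is_link_def using digits by blast
qed

section \<open>Infinite concatenation of words\<close>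

definition word_start :: "(nat \<Rightarrow> 'a list) \<Rightarrow> nat \<Rightarrow> nat" where
  "word_start w n = length (concat (map w [0..<n]))"

text \<open>For nonempty words the first k + 1 of them already have more than k letters, so position
  k falls inside this prefix.\<close>

definition infinite_concat :: "(nat \<Rightarrow> 'a list) \<Rightarrow> nat \<Rightarrow> 'a" where
  "infinite_concat w k = concat (map w [0..<Suc k]) ! k"

lemma word_start_simps [simp]:
  "word_start w 0 = 0" "word_start w (Suc n) = word_start w n + length (w n)"
  by (simp_all add: word_start_def)

lemma word_start_mono: "m \<le> n \<Longrightarrow> word_start w m \<le> word_start w n"
  by (rule lift_Suc_mono_le[where f = "word_start w"]) simp_all

context
  fixes w :: "nat \<Rightarrow> 'a list"
  assumes nonempty: "\<And>n. w n \<noteq> []"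
begin

lemma word_start_ge: "n \<le> word_start w n"
proof (induction n)
  case (Suc n)
  then show ?case using nonempty[of n] by (cases "w n") auto
qed simp

lemma concat_prefix_nth:
  "m \<le> n \<Longrightarrow> k < word_start w m \<Longrightarrow> concat (map w [0..<n]) ! k = concat (map w [0..<m]) ! k"
proof (induction n rule: dec_induct)
  case (step n)
  have "word_start w m \<le> word_start w n"
    using step.hyps(1) by (rule word_start_mono)
  then have "k < length (concat (map w [0..<n]))" using step.prems unfolding word_start_def by simp
  then show ?case using step by (simp add: nth_append)
qed simp

lemma infinite_concat_nth:
  assumes "i < length (w n)"
  shows "infinite_concat w (word_start w n + i) = w n ! i"
proof -
  let ?k = "word_start w n + i"
  \<comment> \<open>Either prefix may be the longer one; both contain the position, so they agree
    there.\<close>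
  have k: "?k < word_start w (Suc n)" "?k < word_start w (Suc ?k)"
    using assms word_start_ge[of "Suc ?k"] by simp_all
  have "infinite_concat w ?k = concat (map w [0..<Suc n]) ! ?k"
    unfolding infinite_concat_def
    using concat_prefix_nth[OF _ k(1), of "Suc ?k"] concat_prefix_nth[OF _ k(2), of "Suc n"]
    by (cases "Suc n \<le> Suc ?k") auto
  then show ?thesis using assms by (simp add: nth_append word_start_def)
qed

lemma map_infinite_concat:
  "map (infinite_concat w) [word_start w n..<word_start w n + length (w n)] = w n"
  by (rule nth_equalityI) (auto simp: infinite_concat_nth)

lemma infinite_concat_position:
  obtains n i where "k = word_start w n + i" "i < length (w n)"
proof -
  have "\<exists>n i. k = word_start w n + i \<and> i < length (w n)"
  proof (induction k)
    case 0
    have "0 = word_start w 0 + 0 \<and> 0 < length (w 0)" using nonempty by simp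
    then show ?case by blast
  next
    case (Suc k)
    then obtain n i where ni: "k = word_start w n + i" "i < length (w n)" by blast
    show ?case
    proof (cases "Suc i < length (w n)")
      case True
      then show ?thesis using ni by (intro exI[of _ n] exI[of _ "Suc i"]) simp
    next
      case False
      then show ?thesis using ni nonempty[of "Suc n"]
        by (intro exI[of _ "Suc n"] exI[of _ 0]) simp
    qed
  qed
  then show ?thesis using that by blast
qed

end

text \<open>Links at the same point fit together, so links with tolerances 1/(n + 1) are
  concatenated. The vanishing tolerances bound the limsup by b; the value above b in each word gives
  the lower bound and attainability at once.\<close>

lemma attainable_of_links:
  assumes links: "\<And>\<delta>. 0 < \<delta> \<Longrightarrow> \<exists>w. is_link x y b \<delta> w"
  shows "\<exists>\<alpha>. \<alpha> \<notin> \<rat> \<and> attainable \<alpha> \<and> lagrange_constant \<alpha> = ereal b"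
proof -
  define \<delta> where "\<delta> n = 1 / (real n + 1)" for n :: nat
  have "\<forall>n. \<exists>w. is_link x y b (\<delta> n) w" using links by (simp add: \<delta>_def)
  then obtain w where w: "\<And>n. is_link x y b (\<delta> n) (w n)" by metis
  have nonempty: "w n \<noteq> []" for n
    using w[of n] unfolding is_link_def by (force dest!: bspec[of _ _ 0])
  define s where "s = infinite_concat w"
  define S where "S = word_start w"
  have s_pos: "1 \<le> s k" for k
  proof -
    obtain n i where "k = word_start w n + i" "i < length (w n)"
      using infinite_concat_position[of w, OF nonempty] .
    then have "s k = w n ! i" "w n ! i \<in> set (w n)"
      by (simp_all add: s_def infinite_concat_nth[of w, OF nonempty])
    then show ?thesis using w[of n] unfolding is_link_def by metis
  qed
  obtain t :: "nat \<Rightarrow> real" where "cf_expansion s t" using cf_expansion_exists[of s, OF s_pos] ..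
  then interpret cf_expansion s t .
  have t01: "t k \<in> {0..1}" and p01: "past s k \<in> {0..1}" for k
    using t_pos[of k] t_le_1[of k] past_bounds[of s k, OF s_pos] by auto
  have word: "map s [S n..<S (Suc n)] = w n" for n
    using map_infinite_concat[of w, OF nonempty] by (simp add: s_def S_def)
  have S_le: "S n \<le> S (Suc n)" for n by (simp add: S_def)
  have t_S: "t (S n) = word_val (w n) (t (S (Suc n)))" for n
    using t_eq_word_val[OF S_le] unfolding word .
  have past_S: "past s (S (Suc n)) = word_val (rev (w n)) (past s (S n))" for n
    using past_eq_word_val[of "S n" "S (Suc n)" s, OF S_le] unfolding word .
  have vals: "cf_value s t (S n + i) = entry_val (w n) i (t (S (Suc n))) (past s (S n))"
    if "i < length (w n)" for n i
    using cf_value_eq_entry_val[OF that, of "S n"] word[of n] by (simp add: S_def)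
  \<comment> \<open>Word n + 1 has a predecessor and a successor, whose link bounds control the past
    at its start and the tail at its end. Word 0 is left out, as the initial past 0 may be far from
    y.\<close>
  have up: "cf_value s t (S (Suc n) + i) \<le> b + 3 * \<delta> n" if i: "i < length (w (Suc n))" for n i
  proof -
    have "\<bar>t (S (Suc (Suc n))) - x\<bar> \<le> \<delta> (Suc (Suc n))"
      using w[of "Suc (Suc n)"] t01 p01 unfolding is_link_def t_S[of "Suc (Suc n)"] by blast
    moreover have "\<bar>past s (S (Suc n)) - y\<bar> \<le> \<delta> n"
      using w[of n] t01 p01 unfolding is_link_def past_S[of n] by blast
    moreover have "cf_value s t (S (Suc n) + i)
        \<le> b + \<delta> (Suc n) + \<bar>t (S (Suc (Suc n))) - x\<bar> + \<bar>past s (S (Suc n)) - y\<bar>"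
      using w[of "Suc n"] t01 p01 i unfolding is_link_def vals[OF i] by blast
    moreover have "\<delta> (Suc n) \<le> \<delta> n" "\<delta> (Suc (Suc n)) \<le> \<delta> n"
      unfolding \<delta>_def by (simp_all add: field_simps)
    ultimately show ?thesis by linarith
  qed
  have freq: "\<exists>\<^sub>F k in sequentially. b \<le> cf_value s t k"
    unfolding frequently_sequentially
  proof
    fix n
    obtain i where i: "i < length (w n)" "b < entry_val (w n) i (t (S (Suc n))) (past s (S n))"
      using w[of n] t01 p01 unfolding is_link_def by blast
    have "n \<le> S n + i" using word_start_ge[of w n, OF nonempty] by (simp add: S_def)
    moreover have "b \<le> cf_value s t (S n + i)" using i vals by simp
    ultimately show "\<exists>k\<ge>n. b \<le> cf_value s t k" by blast
  qed
  have lim: "limsup (\<lambda>k. ereal (cf_value s t k)) = ereal b"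
  proof (rule limsup_eq_erealI[OF _ freq])
    fix e :: real assume e: "0 < e"
    obtain N :: nat where N: "3 / e < N" using reals_Archimedean2 by blast
    have "cf_value s t k \<le> b + e" if k: "S (Suc N) \<le> k" for k
    proof -
      obtain n i where ni: "k = S n + i" "i < length (w n)"
        using infinite_concat_position[of w, OF nonempty] unfolding S_def .
      have "\<not> n \<le> N"
      proof
        assume "n \<le> N"
        then have "S (Suc n) \<le> S (Suc N)" unfolding S_def by (intro word_start_mono) simp
        moreover have "k < S (Suc n)" using ni by (simp add: S_def)
        ultimately show False using k by simp
      qed
      then obtain n' where n': "n = Suc n'" "N \<le> n'" by (cases n) auto
      have "3 / e < real n' + 1" using N n' by linarith
      then have "3 * \<delta> n' \<le> e" using e unfolding \<delta>_def by (simp add: field_simps)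
      then show ?thesis using up[of i n'] ni n' by simp
    qed
    then show "\<forall>\<^sub>F k in sequentially. cf_value s t k \<le> b + e"
      unfolding eventually_sequentially by blast
  qed
  have b: "lagrange_constant (real_of_int 0 + t 0) = ereal b"
    unfolding lagrange_constant_eq by (rule lim)
  have "0 < b"
  proof -
    have "ereal 1 \<le> limsup (\<lambda>k. ereal (cf_value s t k))"
      using cf_value_ge_1 by (intro le_Limsup) (auto intro: always_eventually)
    then show ?thesis unfolding lim by simp
  qed
  with b freq have "attainable (real_of_int 0 + t 0)" by (intro attainable_if_frequently) auto
  with b irrational[of 0] show ?thesis by blast
qed

section \<open>Limits of the spectrum from the right\<close>

lemma compact_accumulation_point:
  fixes f :: "nat \<Rightarrow> 'a :: metric_space"
  assumes "compact C" "\<And>n. f n \<in> C"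
  shows "\<exists>c\<in>C. \<forall>e>0. \<exists>\<^sub>F n in sequentially. dist (f n) c < e"
proof -
  obtain c r where c: "c \<in> C" "strict_mono r" "(f \<circ> r) \<longlonglongrightarrow> c"
    using assms unfolding compact_eq_seq_compact_metric seq_compact_def by metis
  have "\<exists>\<^sub>F n in sequentially. dist (f n) c < e" if "0 < e" for e
    unfolding frequently_sequentially
  proof
    fix N
    obtain M where M: "\<forall>n\<ge>M. dist ((f \<circ> r) n) c < e"
      using c(3) \<open>0 < e\<close> unfolding lim_sequentially by blast
    have "N \<le> r (max M N)" using seq_suble[OF c(2), of "max M N"] by simp
    moreover have "dist (f (r (max M N))) c < e" using M by simp
    ultimately show "\<exists>n\<ge>N. dist (f n) c < e" by blast
  qed
  with c(1) show ?thesis by blast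
qed

text \<open>Compactness acts twice: each expansion has a recurrent state \<open>c n\<close>, and
  these states accumulate at one (x, y). A single point for all tolerances lets words from different
  expansions be joined.\<close>

lemma attainable_of_right_limit:
  assumes "\<And>e. 0 < e \<Longrightarrow> \<exists>l\<in>lagrange_spectrum. b < l \<and> l < b + e"
  shows "\<exists>\<alpha>. \<alpha> \<notin> \<rat> \<and> attainable \<alpha> \<and> lagrange_constant \<alpha> = ereal b"
proof -
  define P where "P n a t l \<longleftrightarrow> cf_expansion a t \<and> limsup (\<lambda>k. ereal (cf_value a t k)) = ereal l
      \<and> b < l \<and> l < b + 1 / (real n + 1)" for n :: nat and a :: "nat \<Rightarrow> int" and t :: "nat \<Rightarrow> real" and l :: real
  have "\<exists>a t l. P n a t l" for n :: nat
  proof -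
    have "0 < 1 / (real n + 1)" by simp
    from assms[OF this] show ?thesis unfolding P_def Bex_def lagrange_spectrum_iff by blast
  qed
  then obtain a t l where P: "\<And>n. P n (a n) (t n) (l n)" by metis
  define z where "z n k = (t n k, past (a n) k)" for n k
  let ?C = "{0..1::real} \<times> {0..1::real}"
  have C: "compact ?C" by (intro compact_Times compact_Icc)
  have z: "z n k \<in> ?C" for n k
  proof -
    interpret cf_expansion "a n" "t n" using P unfolding P_def by blast
    show ?thesis using t_pos[of k] t_le_1[of k] past_bounds[of "a n" k, OF a_pos]
      by (simp add: z_def)
  qed
  have "\<exists>c. c \<in> ?C \<and> (\<forall>e>0. \<exists>\<^sub>F k in sequentially. dist (z n k) c < e)" for n
    using compact_accumulation_point[of ?C "z n", OF C z] by blast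
  then obtain c where c: "\<And>n. c n \<in> ?C"
    "\<And>n. \<forall>e>0. \<exists>\<^sub>F k in sequentially. dist (z n k) (c n) < e"
    by metis
  obtain x y where xy: "\<And>e. 0 < e \<Longrightarrow> \<exists>\<^sub>F n in sequentially. dist (c n) (x, y) < e"
    using compact_accumulation_point[of ?C c, OF C c(1)] by auto
  show ?thesis
  proof (rule attainable_of_links)
    fix \<delta> :: real assume \<delta>: "0 < \<delta>"
    \<comment> \<open>This makes \<open>l n\<close> - b smaller than \<delta>/2; two distances of
      \<delta>/16 will make up the \<delta>/8 of \<open>link_exists\<close>.\<close>
    obtain N :: nat where N: "2 / \<delta> < N" using reals_Archimedean2 by blast
    obtain n where n: "N \<le> n" "dist (c n) (x, y) < \<delta> / 16"
      using xy[of "\<delta> / 16"] \<delta> unfolding frequently_sequentially by auto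
    interpret cf_expansion "a n" "t n" using P unfolding P_def by blast
    have "2 / \<delta> < real n + 1" using N n by linarith
    then have "1 / (real n + 1) \<le> \<delta> / 2" using \<delta> by (simp add: field_simps)
    then have l: "limsup (\<lambda>k. ereal (cf_value (a n) (t n) k)) = ereal (l n)" "b < l n" "l n < b + \<delta> / 2"
      using P[of n] unfolding P_def by auto
    have "\<exists>\<^sub>F k in sequentially. dist (z n k) (c n) < \<delta> / 16" using c(2)[rule_format, of "\<delta> / 16" n] \<delta> by simp
    then have "\<exists>\<^sub>F k in sequentially. \<bar>t n k - x\<bar> < \<delta> / 8 \<and> \<bar>past (a n) k - y\<bar> < \<delta> / 8"
    proof (rule frequently_elim1)
      fix k assume "dist (z n k) (c n) < \<delta> / 16"
      then have "dist (z n k) (x, y) < \<delta> / 8"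
        using n(2) dist_triangle[of "z n k" "(x, y)" "c n"] by linarith
      then show "\<bar>t n k - x\<bar> < \<delta> / 8 \<and> \<bar>past (a n) k - y\<bar> < \<delta> / 8"
        using dist_fst_le[of "z n k" "(x, y)"] dist_snd_le[of "z n k" "(x, y)"]
        by (simp add: z_def dist_real_def)
    qed
    then show "\<exists>w. is_link x y b \<delta> w" by (rule link_exists[OF l])
  qed
qed

theorem theorem2:
  fixes l :: real
  assumes "l \<in> lagrange_spectrum"
    and "\<not> (\<exists>b. maximal_gap l b)"
  shows "\<exists>\<alpha>::real. \<alpha> \<notin> \<rat> \<and> attainable \<alpha> \<and> lagrange_constant \<alpha> = ereal l"
proof (rule attainable_of_right_limit, rule ccontr)
  fix e :: real
  assume e: "0 < e" and no: "\<not> (\<exists>l'\<in>lagrange_spectrum. l < l' \<and> l' < l + e)"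
  \<comment> \<open>The infimum of the spectrum above l is the candidate right endpoint of a gap
    starting at l.\<close>
  define A where "A = lagrange_spectrum \<inter> {l<..}"
  define b where "b = Inf A"
  have A: "A \<noteq> {}" using lagrange_spectrum_unbounded[of l] by (auto simp: A_def)
  have low: "l + e \<le> r" if "r \<in> A" for r using no that by (force simp: A_def)
  then have bdd: "bdd_below A" by (auto simp: bdd_below_def)
  have "l + e \<le> b" unfolding b_def using A low by (rule cInf_greatest)
  then have "l < b" using e by simp
  have b_le: "b \<le> r" if "r \<in> A" for r unfolding b_def using that bdd by (rule cInf_lower)
  \<comment> \<open>Closedness from the right comes from the same construction: an infimum outside
    the spectrum would be a limit of its points from the right, hence a Lagrange constant.\<close>
  have "b \<in> lagrange_spectrum"
  proof (rule ccontr)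
    assume b: "b \<notin> lagrange_spectrum"
    have "\<exists>l\<in>lagrange_spectrum. b < l \<and> l < b + e'" if "0 < e'" for e'
    proof -
      obtain r where r: "r \<in> A" "r < b + e'"
        using cInf_lessD[OF A, of "b + e'"] \<open>0 < e'\<close> unfolding b_def by auto
      then have "r \<in> lagrange_spectrum" by (simp add: A_def)
      moreover have "b < r" using b_le[OF r(1)] b calculation by (cases "b = r") auto
      ultimately show ?thesis using r by blast
    qed
    then have "\<exists>\<alpha>. \<alpha> \<notin> \<rat> \<and> attainable \<alpha> \<and> lagrange_constant \<alpha> = ereal b"
      by (rule attainable_of_right_limit)
    with b show False unfolding lagrange_spectrum_def by blast
  qed
  moreover have "{l<..<b} \<inter> lagrange_spectrum = {}"
    using b_le by (force simp: A_def)
  ultimately have "maximal_gap l b"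
    using assms(1) \<open>l < b\<close> by (simp add: maximal_gap_iff)
  with assms(2) show False by blast
qed

end
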